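(* Let $n\ge 1$ and let $s=(s_1,\dots,s_n)\in\mathbb{Z}^n$ be a score vector whose entries $s_1,\dots,s_n$ are pairwise distinct. Then the frequency vector of $s$ is the X-ray of some $n\times n$ doubly stochastic matrix.
   Context: Write $[n]=\{1,\dots,n\}$. A vector $s=(s_1,\dots,s_n)\in\mathbb{Z}^n$ is a score vector if it satisfies the permutohedral constraints: $\left|\sum_{i\in I}s_i\right|\le |I|(n-|I|)$ for all $I\subseteq[n]$ (in particular $\sum_i s_i=0$ and $|s_i|\le n-1$ for every $i$). The frequency vector of a vector $s\in\{-n+1,\dots,n-1\}^n$ is $x=(x_{-n+1},\dots,x_0,\dots,x_{n-1})\in\mathbb{N}^{2n-1}$, where $x_d$ is the number of indices $i\in[n]$ with $s_i=d$. The (diagonal) X-ray of an $n\times n$ real matrix $A=(a_{i,j})$ is the vector $x(A)=(x_{-n+1},\dots,x_{n-1})\in\mathbb{R}^{2n-1}$ with $x_d=\sum_{i,j\in[n],\ i-j=d}a_{i,j}$ for $-n+1\le d\le n-1$. A doubly stochastic matrix is a non-negative real square matrix all of whose rows and columns sum to $1$. *)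

theory Defs
  imports Complex_Main
begin

(* Vectors of length n and n x n matrices are functions on nat of which only the
   values at indices in {1..n} are used.  Vectors indexed by the diagonals
   -n+1, ..., n-1 are functions on int of which only the values at d in diagonals n
   are used. *)

definition diagonals :: "nat \<Rightarrow> int set" where
  "diagonals n = {- int n + 1 .. int n - 1}"

definition score_vector :: "nat \<Rightarrow> (nat \<Rightarrow> int) \<Rightarrow> bool" where
  "score_vector n s \<longleftrightarrow>
     (\<forall>I \<subseteq> {1..n}. \<bar>\<Sum>i\<in>I. s i\<bar> \<le> int (card I) * (int n - int (card I)))"

definition frequency_vector :: "nat \<Rightarrow> (nat \<Rightarrow> int) \<Rightarrow> int \<Rightarrow> nat" where
  "frequency_vector n s d = card {i \<in> {1..n}. s i = d}"

definition xray :: "nat \<Rightarrow> (nat \<Rightarrow> nat \<Rightarrow> real) \<Rightarrow> int \<Rightarrow> real" where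
  "xray n A d =
     (\<Sum>(i, j) \<in> {(i, j) \<in> {1..n} \<times> {1..n}. int i - int j = d}. A i j)"

definition doubly_stochastic :: "nat \<Rightarrow> (nat \<Rightarrow> nat \<Rightarrow> real) \<Rightarrow> bool" where
  "doubly_stochastic n A \<longleftrightarrow>
     (\<forall>i\<in>{1..n}. \<forall>j\<in>{1..n}. 0 \<le> A i j) \<and>
     (\<forall>i\<in>{1..n}. (\<Sum>j\<in>{1..n}. A i j) = 1) \<and>
     (\<forall>j\<in>{1..n}. (\<Sum>i\<in>{1..n}. A i j) = 1)"

end

theory Submission
  imports Defs
begin

text \<open>
  Reversing the order of the columns turns the diagonals into antidiagonals: the cell with
  row \<open>i\<close> and new column \<open>j\<close> lies on the antidiagonal \<open>i + j\<close>, and the entry \<open>s\<^sub>k\<close> of the score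
  vector asks for total mass 1 on the antidiagonal \<open>\<mu>\<^sub>k = s\<^sub>k + n + 1\<close> of \<open>{2..2n}\<close>. The score
  inequalities say exactly that \<open>(\<mu>\<^sub>1, \<dots>, \<mu>\<^sub>n)\<close> is majorized by \<open>(2, 4, \<dots>, 2n)\<close>.

  Existence of the matrix is a linear feasibility problem, and symmetric solutions suffice because
  transposition preserves antidiagonals. By Farkas' lemma it is solvable iff
  \<open>\<Sum>\<^sub>k y(\<mu>\<^sub>k) \<le> 2 \<Sum>\<^sub>i u\<^sub>i\<close> whenever \<open>y(i + j) \<le> u\<^sub>i + u\<^sub>j\<close> for all \<open>i, j\<close>
  (lemma \<open>dual_inequality\<close>).

  To prove this, let \<open>\<phi>\<close> be the greatest convex function below the points \<open>(2i, 2u\<^sub>i)\<close>. Split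
  \<open>y \<le> \<phi> + max 0 (y - \<phi>)\<close>. Majorization gives \<open>\<Sum>\<^sub>k \<phi>(\<mu>\<^sub>k) \<le> \<Sum>\<^sub>k \<phi>(2k)\<close>, and since the \<open>\<mu>\<^sub>k\<close>
  are distinct, the excess over the \<open>\<mu>\<^sub>k\<close> is at most the excess over all of \<open>{2..2n}\<close>. It remains to
  see that this total excess is at most \<open>\<Sum>\<^sub>k (2u\<^sub>k - \<phi>(2k))\<close>. On an edge \<open>[2a, 2b]\<close> of the
  graph of \<open>\<phi>\<close>, every \<open>m\<close> strictly between the end points is \<open>k + a\<close> or \<open>k + b\<close> with
  \<open>a < k < b\<close>, or else \<open>a + b\<close>; as \<open>\<phi>\<close> is affine there and equals \<open>2u\<close> at both ends,
  \<open>y(k + a)\<close> and \<open>y(k + b)\<close> exceed \<open>\<phi>\<close> by at most \<open>u\<^sub>k - \<phi>(2k) / 2\<close>, and \<open>y(a + b)\<close> does not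
  exceed it. So each \<open>k\<close> is charged at most twice, once through either end of its edge.
\<close>

section \<open>A theorem of the alternative\<close>

text \<open>
  Farkas' lemma by induction on the number of generators (Bartl's argument). If the generator
  \<open>k\<close> cannot be dropped, some \<open>z\<close> satisfies the other constraints but has \<open>b \<bullet> z > 0\<close>, hence
  \<open>G k \<bullet> z > 0\<close>. Projecting along \<open>z\<close> onto the kernel of \<open>G k\<close> reduces to the remaining
  generators, and the signs at \<open>z\<close> make the coefficient of \<open>G k\<close> nonnegative.
\<close>

lemma farkas:
  fixes G :: "'k \<Rightarrow> 'i \<Rightarrow> real" and b :: "'i \<Rightarrow> real"
  assumes "finite K"
    and "\<And>x. (\<And>k. k \<in> K \<Longrightarrow> (\<Sum>i\<in>I. G k i * x i) \<le> 0) \<Longrightarrow> (\<Sum>i\<in>I. b i * x i) \<le> 0"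
    and I: "finite I"
  shows "\<exists>c. (\<forall>k\<in>K. 0 \<le> c k) \<and> (\<forall>i\<in>I. b i = (\<Sum>k\<in>K. c k * G k i))"
  using assms(1,2)
proof (induction K arbitrary: G b rule: finite_induct)
  case empty
  have "(\<Sum>i\<in>I. b i * b i) \<le> 0"
    by (rule empty) simp
  moreover have "(\<Sum>i\<in>I. b i * b i) \<ge> 0"
    by (rule sum_nonneg) simp
  ultimately have "\<forall>i\<in>I. b i * b i = 0"
    using sum_nonneg_eq_0_iff[OF I, of "\<lambda>i. b i * b i"] by simp
  then show ?case by simp
next
  case (insert k K)
  show ?case
  proof (cases "\<forall>x. (\<forall>l\<in>K. (\<Sum>i\<in>I. G l i * x i) \<le> 0) \<longrightarrow> (\<Sum>i\<in>I. b i * x i) \<le> 0")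
    case True
    then obtain c where c: "\<forall>l\<in>K. 0 \<le> c l" "\<forall>i\<in>I. b i = (\<Sum>l\<in>K. c l * G l i)"
      using insert.IH[of G b] by blast
    have "(\<Sum>l\<in>K. (c(k := 0)) l * G l i) = (\<Sum>l\<in>K. c l * G l i)" for i
      using insert.hyps by (intro sum.cong) auto
    then show ?thesis
      using c insert.hyps by (intro exI[of _ "c(k := 0)"]) auto
  next
    case False
    then obtain z where z: "\<And>l. l \<in> K \<Longrightarrow> (\<Sum>i\<in>I. G l i * z i) \<le> 0"
      and bz: "(\<Sum>i\<in>I. b i * z i) > 0"
      by (auto simp: not_le)
    have kz: "(\<Sum>i\<in>I. G k i * z i) > 0"
      using insert.prems[of z] z bz by fastforce
    define r where "r = (\<Sum>i\<in>I. G k i * z i)"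
    define h where "h l = (\<Sum>i\<in>I. G l i * z i) / r" for l
    define e where "e = (\<Sum>i\<in>I. b i * z i) / r"
    have r: "r > 0" using kz by (simp add: r_def)
    have proj: "(\<Sum>i\<in>I. (g i - (\<Sum>i\<in>I. g i * z i) / r * G k i) * x i)
        = (\<Sum>i\<in>I. g i * (x i - (\<Sum>i\<in>I. G k i * x i) / r * z i))" for g x
    proof -
      define \<gamma> \<xi> where "\<gamma> = (\<Sum>i\<in>I. g i * z i) / r" and "\<xi> = (\<Sum>i\<in>I. G k i * x i) / r"
      have "(\<Sum>i\<in>I. (g i - \<gamma> * G k i) * x i) = (\<Sum>i\<in>I. g i * x i) - \<gamma> * (\<Sum>i\<in>I. G k i * x i)"
        by (simp add: left_diff_distrib sum_subtractf sum_distrib_left mult.assoc)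
      moreover have "(\<Sum>i\<in>I. g i * (x i - \<xi> * z i)) = (\<Sum>i\<in>I. g i * x i) - \<xi> * (\<Sum>i\<in>I. g i * z i)"
        by (simp add: right_diff_distrib sum_subtractf sum_distrib_left mult.left_commute)
      ultimately show ?thesis
        by (simp add: \<gamma>_def \<xi>_def)
    qed
    \<comment> \<open>The functionals composed with the projection \<open>x \<mapsto> x - (G k \<bullet> x / r) z\<close> satisfy the
      hypothesis for \<open>K\<close>, because \<open>G k\<close> vanishes on its image.\<close>
    have "\<exists>c. (\<forall>l\<in>K. 0 \<le> c l) \<and> (\<forall>i\<in>I. b i - e * G k i = (\<Sum>l\<in>K. c l * (G l i - h l * G k i)))"
    proof (rule insert.IH)
      fix x
      assume le: "\<And>l. l \<in> K \<Longrightarrow> (\<Sum>i\<in>I. (G l i - h l * G k i) * x i) \<le> 0"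
      define x' where "x' i = x i - (\<Sum>i\<in>I. G k i * x i) / r * z i" for i
      have "(\<Sum>i\<in>I. G l i * x' i) \<le> 0" if "l \<in> insert k K" for l
      proof (cases "l = k")
        case True
        have "(\<Sum>i\<in>I. G k i * x' i) = (\<Sum>i\<in>I. (G k i - 1 * G k i) * x i)"
          using proj[of "G k" x] r by (simp add: x'_def r_def)
        then show ?thesis using True by simp
      next
        case False
        then show ?thesis using le[of l] that proj[of "G l" x] by (simp add: x'_def h_def)
      qed
      then have "(\<Sum>i\<in>I. b i * x' i) \<le> 0"
        by (rule insert.prems)
      then show "(\<Sum>i\<in>I. (b i - e * G k i) * x i) \<le> 0"
        using proj[of b x] by (simp add: x'_def e_def)
    qed
    then obtain c where c: "\<And>l. l \<in> K \<Longrightarrow> 0 \<le> c l"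
      and eq: "\<And>i. i \<in> I \<Longrightarrow> b i - e * G k i = (\<Sum>l\<in>K. c l * (G l i - h l * G k i))"
      by blast
    define c' where "c' = c(k := e - (\<Sum>l\<in>K. c l * h l))"
    have K: "(\<Sum>l\<in>K. c' l * G l i) = (\<Sum>l\<in>K. c l * G l i)" for i
      using insert.hyps by (intro sum.cong) (auto simp: c'_def)
    have "(\<Sum>l\<in>K. c l * h l) \<le> 0"
      using c z r by (intro sum_nonpos) (simp add: h_def mult_nonneg_nonpos divide_nonpos_pos)
    moreover have "e > 0" using bz r by (simp add: e_def)
    ultimately have "0 \<le> c' k" by (simp add: c'_def)
    moreover have "b i = (\<Sum>l\<in>insert k K. c' l * G l i)" if "i \<in> I" for i
    proof -
      have "(\<Sum>l\<in>K. c l * (G l i - h l * G k i))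
          = (\<Sum>l\<in>K. c l * G l i) - (\<Sum>l\<in>K. c l * h l) * G k i"
        by (simp add: right_diff_distrib sum_subtractf sum_distrib_right mult.assoc)
      then show ?thesis
        using eq[OF that] insert.hyps by (simp add: K) (simp add: c'_def algebra_simps)
    qed
    ultimately show ?thesis
      using c insert.hyps by (intro exI[of _ c']) (auto simp: c'_def)
  qed
qed

section \<open>Convex sequences and majorization\<close>

lemma sum_second_differences:
  fixes \<phi> :: "nat \<Rightarrow> real"
  assumes "p \<le> m"
  shows "(\<Sum>c\<in>{p<..m}. \<phi> (Suc c) - 2 * \<phi> c + \<phi> (c - 1)) = \<phi> (Suc m) - \<phi> m - (\<phi> (Suc p) - \<phi> p)"
  using assms
proof (induction m rule: dec_induct)
  case (step m)
  then have "{p<..Suc m} = insert (Suc m) {p<..m}" by auto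
  then show ?case using step by simp
qed simp

text \<open>
  A function on an interval of integers is an affine function plus a combination of the hinges
  \<open>m \<mapsto> max 0 (m - c)\<close>, weighted by its second differences. For a convex function the weights
  are nonnegative, so inequalities for hinges carry over to all convex functions.
\<close>

lemma hinge_expansion:
  fixes \<phi> :: "nat \<Rightarrow> real"
  assumes "p \<le> m" "m \<le> q"
  shows "\<phi> m = \<phi> p + (real m - real p) * (\<phi> (Suc p) - \<phi> p)
    + (\<Sum>c\<in>{p<..<q}. (\<phi> (Suc c) - 2 * \<phi> c + \<phi> (c - 1)) * max 0 (real m - real c))"
  using assms
proof (induction m rule: dec_induct)
  case base
  have "(\<Sum>c\<in>{p<..<q}. (\<phi> (Suc c) - 2 * \<phi> c + \<phi> (c - 1)) * max 0 (real p - real c)) = 0"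
    by (intro sum.neutral) auto
  then show ?case by simp
next
  case (step m)
  let ?\<kappa> = "\<lambda>c. \<phi> (Suc c) - 2 * \<phi> c + \<phi> (c - 1)"
  have "(\<Sum>c\<in>{p<..<q}. ?\<kappa> c * max 0 (real (Suc m) - real c)) - (\<Sum>c\<in>{p<..<q}. ?\<kappa> c * max 0 (real m - real c))
     = (\<Sum>c\<in>{p<..<q}. ?\<kappa> c * (max 0 (real (Suc m) - real c) - max 0 (real m - real c)))"
    by (simp add: right_diff_distrib sum_subtractf)
  also have "\<dots> = (\<Sum>c\<in>{p<..<q}. if c \<le> m then ?\<kappa> c else 0)"
    by (intro sum.cong) auto
  also have "\<dots> = (\<Sum>c\<in>{p<..<q} \<inter> {c. c \<le> m}. ?\<kappa> c)"
    by (simp add: sum.If_cases)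
  also have "{p<..<q} \<inter> {c. c \<le> m} = {p<..m}" using step by auto
  also have "(\<Sum>c\<in>{p<..m}. ?\<kappa> c) = \<phi> (Suc m) - \<phi> m - (\<phi> (Suc p) - \<phi> p)"
    using step by (intro sum_second_differences) simp
  finally show ?case using step by (simp add: algebra_simps)
qed

lemma sum_top_evens:
  assumes "q \<le> n"
  shows "(\<Sum>k\<in>{n - q<..n}. 2 * real k) = real q * (2 * real n + 1 - real q)"
  using assms
proof (induction q)
  case (Suc q)
  then have "{n - Suc q<..n} = insert (n - q) {n - q<..n}" by auto
  then show ?case using Suc by (simp add: of_nat_diff algebra_simps)
qed simp

text \<open>
  Only the entries above \<open>t\<close> contribute on the left; if there are \<open>q\<close> of them, their sum is at most
  that of the \<open>q\<close> largest even numbers \<open>2(n - q + 1), \<dots>, 2n\<close>, which is \<open>q (2n + 1 - q)\<close>.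
\<close>

lemma hinge_majorization:
  fixes \<mu> :: "nat \<Rightarrow> nat" and t :: real
  assumes top: "\<forall>I\<subseteq>{1..n}. (\<Sum>k\<in>I. real (\<mu> k)) \<le> real (card I) * (2 * real n + 1 - real (card I))"
  shows "(\<Sum>k=1..n. max 0 (real (\<mu> k) - t)) \<le> (\<Sum>k=1..n. max 0 (2 * real k - t))"
proof -
  define I where "I = {k \<in> {1..n}. real (\<mu> k) > t}"
  have I: "I \<subseteq> {1..n}" by (auto simp: I_def)
  then have q: "card I \<le> n" using card_mono[of "{1..n}" I] by simp
  have "(\<Sum>k=1..n. max 0 (real (\<mu> k) - t)) = (\<Sum>k\<in>I. max 0 (real (\<mu> k) - t))"
    using I by (intro sum.mono_neutral_right) (auto simp: I_def)
  also have "\<dots> = (\<Sum>k\<in>I. real (\<mu> k) - t)"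
    by (intro sum.cong) (auto simp: I_def)
  also have "\<dots> \<le> (\<Sum>k\<in>{n - card I<..n}. 2 * real k - t)"
    using top[rule_format, OF I] sum_top_evens[OF q] q by (simp add: sum_subtractf)
  also have "\<dots> \<le> (\<Sum>k\<in>{n - card I<..n}. max 0 (2 * real k - t))"
    by (intro sum_mono) simp
  also have "\<dots> \<le> (\<Sum>k=1..n. max 0 (2 * real k - t))"
    by (intro sum_mono2) auto
  finally show ?thesis .
qed

text \<open>
  The easy direction of the Hardy--Littlewood--Polya theorem, with \<open>(2, 4, \<dots>, 2n)\<close> as the
  majorizing sequence: the affine parts of both sums agree since the totals do, and the hinges are
  compared one by one.
\<close>

lemma convex_majorization:
  fixes \<mu> :: "nat \<Rightarrow> nat" and \<phi> :: "nat \<Rightarrow> real"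
  assumes range: "\<mu> ` {1..n} \<subseteq> {2..2 * n}"
    and top: "\<forall>I\<subseteq>{1..n}. (\<Sum>k\<in>I. real (\<mu> k)) \<le> real (card I) * (2 * real n + 1 - real (card I))"
    and total: "(\<Sum>k=1..n. real (\<mu> k)) = real n * (real n + 1)"
    and convex: "\<forall>c\<in>{2<..<2 * n}. 2 * \<phi> c \<le> \<phi> (c - 1) + \<phi> (Suc c)"
  shows "(\<Sum>k=1..n. \<phi> (\<mu> k)) \<le> (\<Sum>k=1..n. \<phi> (2 * k))"
proof -
  let ?\<kappa> = "\<lambda>c. \<phi> (Suc c) - 2 * \<phi> c + \<phi> (c - 1)"
  have \<mu>: "2 \<le> \<mu> k \<and> \<mu> k \<le> 2 * n" if "k \<in> {1..n}" for k
    using subsetD[OF range imageI[OF that]] by simp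
  have expand: "(\<Sum>k=1..n. \<phi> (\<nu> k)) = (\<Sum>k=1..n. \<phi> 2)
      + ((\<Sum>k=1..n. real (\<nu> k)) - 2 * real n) * (\<phi> 3 - \<phi> 2)
      + (\<Sum>c\<in>{2<..<2 * n}. ?\<kappa> c * (\<Sum>k=1..n. max 0 (real (\<nu> k) - real c)))"
    if "\<And>k. k \<in> {1..n} \<Longrightarrow> \<nu> k \<in> {2..2 * n}" for \<nu>
  proof -
    have "(\<Sum>k=1..n. \<phi> (\<nu> k)) = (\<Sum>k=1..n. \<phi> 2 + (real (\<nu> k) - 2) * (\<phi> 3 - \<phi> 2)
        + (\<Sum>c\<in>{2<..<2 * n}. ?\<kappa> c * max 0 (real (\<nu> k) - real c)))"
      using that by (intro sum.cong refl, subst hinge_expansion[of 2 _ "2 * n"]) (auto simp: eval_nat_numeral)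
    also have "\<dots> = (\<Sum>k=1..n. \<phi> 2) + (\<Sum>k=1..n. (real (\<nu> k) - 2)) * (\<phi> 3 - \<phi> 2)
        + (\<Sum>k=1..n. \<Sum>c\<in>{2<..<2 * n}. ?\<kappa> c * max 0 (real (\<nu> k) - real c))"
      by (simp only: sum.distrib sum_distrib_right)
    also have "(\<Sum>k=1..n. \<Sum>c\<in>{2<..<2 * n}. ?\<kappa> c * max 0 (real (\<nu> k) - real c))
        = (\<Sum>c\<in>{2<..<2 * n}. ?\<kappa> c * (\<Sum>k=1..n. max 0 (real (\<nu> k) - real c)))"
      by (subst sum.swap) (simp only: sum_distrib_left)
    finally show ?thesis by (simp add: sum_subtractf)
  qed
  have evens: "(\<Sum>k=1..n. real (2 * k)) = real n * (real n + 1)"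
    using sum_top_evens[of n n] by (simp add: atLeastSucAtMost_greaterThanAtMost)
  have "(\<Sum>c\<in>{2<..<2 * n}. ?\<kappa> c * (\<Sum>k=1..n. max 0 (real (\<mu> k) - real c)))
      \<le> (\<Sum>c\<in>{2<..<2 * n}. ?\<kappa> c * (\<Sum>k=1..n. max 0 (real (2 * k) - real c)))"
  proof (rule sum_mono)
    fix c assume "c \<in> {2<..<2 * n}"
    then have "0 \<le> ?\<kappa> c" using bspec[OF convex, of c] by simp
    moreover have "(\<Sum>k=1..n. max 0 (real (\<mu> k) - real c)) \<le> (\<Sum>k=1..n. max 0 (real (2 * k) - real c))"
      using hinge_majorization[OF top, of "real c"] by simp
    ultimately show "?\<kappa> c * (\<Sum>k=1..n. max 0 (real (\<mu> k) - real c))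
        \<le> ?\<kappa> c * (\<Sum>k=1..n. max 0 (real (2 * k) - real c))"
      by (intro mult_left_mono)
  qed
  then show ?thesis
    using expand[of \<mu>] expand[of "\<lambda>k. 2 * k"] total evens by (simp add: \<mu>)
qed

section \<open>The convex minorant\<close>

text \<open>
  The case in which the convex minorant is a single edge: \<open>\<sigma>\<close> is the slope of \<open>u\<close> from \<open>a\<close> to
  \<open>b\<close>, so the affine function \<open>2 u\<^sub>a + (m - 2a) \<sigma>\<close> takes the values \<open>2 u\<^sub>a\<close> and \<open>2 u\<^sub>b\<close> at
  \<open>2a\<close> and \<open>2b\<close>. Writing \<open>m\<close> as \<open>k + a\<close> below \<open>a + b\<close> and as \<open>k + b\<close> above it charges
  every \<open>k\<close> twice.
\<close>

lemma excess_above_chord: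
  fixes u y :: "nat \<Rightarrow> real"
  assumes "a \<le> b"
    and chord: "u b = u a + (real b - real a) * \<sigma>"
    and above: "\<And>k. k \<in> {a..b} \<Longrightarrow> u a + (real k - real a) * \<sigma> \<le> u k"
    and y: "\<And>i j. i \<in> {a..b} \<Longrightarrow> j \<in> {a..b} \<Longrightarrow> y (i + j) \<le> u i + u j"
  shows "(\<Sum>m\<in>{2 * a<..<2 * b}. max 0 (y m - (2 * u a + (real m - 2 * real a) * \<sigma>)))
      \<le> 2 * (\<Sum>k\<in>{a<..<b}. u k - (u a + (real k - real a) * \<sigma>))"
proof (cases "a = b")
  case False
  let ?e = "\<lambda>m. max 0 (y m - (2 * u a + (real m - 2 * real a) * \<sigma>))"
  let ?d = "\<lambda>k. u k - (u a + (real k - real a) * \<sigma>)"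
  have split: "{2 * a<..<2 * b} = insert (a + b) ((\<lambda>k. k + a) ` {a<..<b} \<union> (\<lambda>k. k + b) ` {a<..<b})"
  proof (intro equalityI subsetI)
    fix m assume m: "m \<in> {2 * a<..<2 * b}"
    consider "m < a + b" | "m = a + b" | "a + b < m" by linarith
    then show "m \<in> insert (a + b) ((\<lambda>k. k + a) ` {a<..<b} \<union> (\<lambda>k. k + b) ` {a<..<b})"
    proof cases
      case 1
      then have "m - a \<in> {a<..<b}" "m = (m - a) + a" using m by auto
      then show ?thesis by blast
    next
      case 3
      then have "m - b \<in> {a<..<b}" "m = (m - b) + b" using m by auto
      then show ?thesis by blast
    qed simp
  qed (use assms(1) False in auto)
  have "?e (a + b) = 0"
    using y[of a b] assms(1) chord by (simp add: algebra_simps)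
  then have "(\<Sum>m\<in>{2 * a<..<2 * b}. ?e m)
      = (\<Sum>m\<in>(\<lambda>k. k + a) ` {a<..<b} \<union> (\<lambda>k. k + b) ` {a<..<b}. ?e m)"
    unfolding split by (subst sum.insert) auto
  also have "\<dots> = (\<Sum>m\<in>(\<lambda>k. k + a) ` {a<..<b}. ?e m) + (\<Sum>m\<in>(\<lambda>k. k + b) ` {a<..<b}. ?e m)"
    by (intro sum.union_disjoint) auto
  also have "\<dots> = (\<Sum>k\<in>{a<..<b}. ?e (k + a)) + (\<Sum>k\<in>{a<..<b}. ?e (k + b))"
    by (simp add: sum.reindex)
  also have "\<dots> \<le> (\<Sum>k\<in>{a<..<b}. ?d k) + (\<Sum>k\<in>{a<..<b}. ?d k)"
  proof (intro add_mono sum_mono)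
    fix k assume k: "k \<in> {a<..<b}"
    then have "?d k \<ge> 0" using above[of k] by simp
    then show "?e (k + a) \<le> ?d k"
      using y[of k a] k by (simp add: algebra_simps)
    show "?e (k + b) \<le> ?d k"
      using y[of k b] k chord \<open>?d k \<ge> 0\<close> by (simp add: algebra_simps)
  qed
  finally show ?thesis by simp
qed simp

text \<open>
  The greatest convex minorant \<open>\<phi>\<close> of the points \<open>(2i, 2u\<^sub>i)\<close>, built by recursion: if \<open>u\<close> stays above
  its chord, \<open>\<phi>\<close> is the chord; otherwise the point \<open>c\<close> farthest below the chord is a vertex, and
  \<open>\<phi>\<close> is glued from the minorants on \<open>[a, c]\<close> and \<open>[c, b]\<close>. The clause that \<open>\<phi>\<close> dominates all
  affine minorants makes the induction go through: the parallel to the chord through \<open>c\<close> is such a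
  minorant, so it separates the slopes on the two sides of \<open>2c\<close> and the glued function is convex
  there. The excess bound is additive, because \<open>y(2c) \<le> 2u\<^sub>c = \<phi>(2c)\<close>.
\<close>

lemma convex_minorant:
  fixes u y :: "nat \<Rightarrow> real"
  assumes "a \<le> b"
    and "\<And>i j. i \<in> {a..b} \<Longrightarrow> j \<in> {a..b} \<Longrightarrow> y (i + j) \<le> u i + u j"
  shows "\<exists>\<phi> :: nat \<Rightarrow> real. \<phi> (2 * a) = 2 * u a \<and> \<phi> (2 * b) = 2 * u b
    \<and> (\<forall>m\<in>{2 * a<..<2 * b}. 2 * \<phi> m \<le> \<phi> (m - 1) + \<phi> (Suc m))
    \<and> (\<forall>p q. (\<forall>i\<in>{a..b}. p + q * real i \<le> u i) \<longrightarrow> (\<forall>m\<in>{2 * a..2 * b}. 2 * p + q * real m \<le> \<phi> m))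
    \<and> (\<Sum>m\<in>{2 * a<..<2 * b}. max 0 (y m - \<phi> m)) + (\<Sum>k\<in>{a<..<b}. \<phi> (2 * k))
        \<le> 2 * (\<Sum>k\<in>{a<..<b}. u k)"
  using assms
proof (induction "b - a" arbitrary: a b rule: less_induct)
  case less
  note y = less.prems(2)
  define \<sigma> where "\<sigma> = (u b - u a) / (real b - real a)"
  have chord: "u b = u a + (real b - real a) * \<sigma>"
    using less.prems(1) by (cases "a = b") (auto simp: \<sigma>_def)
  define gap where "gap k = u k - (u a + (real k - real a) * \<sigma>)" for k
  show ?case
  proof (cases "\<forall>k\<in>{a..b}. gap k \<ge> 0")
    case True
    let ?\<phi> = "\<lambda>m. 2 * u a + (real m - 2 * real a) * \<sigma>"
    have "(\<Sum>m\<in>{2 * a<..<2 * b}. max 0 (y m - ?\<phi> m)) \<le> 2 * (\<Sum>k\<in>{a<..<b}. u k - (u a + (real k - real a) * \<sigma>))"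
      using less.prems True chord by (intro excess_above_chord) (auto simp: gap_def)
    also have "\<dots> = 2 * (\<Sum>k\<in>{a<..<b}. u k) - (\<Sum>k\<in>{a<..<b}. ?\<phi> (2 * k))"
      by (simp add: sum_subtractf[symmetric] sum_distrib_left algebra_simps)
    finally have excess: "(\<Sum>m\<in>{2 * a<..<2 * b}. max 0 (y m - ?\<phi> m)) + (\<Sum>k\<in>{a<..<b}. ?\<phi> (2 * k))
        \<le> 2 * (\<Sum>k\<in>{a<..<b}. u k)" by simp
    \<comment> \<open>An affine function below \<open>u\<close> at both end points is below the chord.\<close>
    have affine: "2 * p + q * real m \<le> ?\<phi> m"
      if p: "\<forall>i\<in>{a..b}. p + q * real i \<le> u i" and m: "m \<in> {2 * a..2 * b}" for p q m
    proof (cases "a = b")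
      case True
      then show ?thesis using p m by auto
    next
      case False
      then have ab: "real b - real a > 0" using less.prems by simp
      have "(real b - real a) * (2 * p + q * real m)
          = (2 * real b - real m) * (p + q * real a) + (real m - 2 * real a) * (p + q * real b)"
        by (simp add: algebra_simps)
      also have "\<dots> \<le> (2 * real b - real m) * u a + (real m - 2 * real a) * u b"
        using p m less.prems by (intro add_mono mult_left_mono) auto
      also have "\<dots> = (real b - real a) * ?\<phi> m"
        by (simp add: chord algebra_simps)
      finally show ?thesis using ab by simp
    qed
    have "\<forall>m\<in>{2 * a<..<2 * b}. 2 * ?\<phi> m \<le> ?\<phi> (m - 1) + ?\<phi> (Suc m)"
      by (auto simp: of_nat_diff algebra_simps)
    then show ?thesis
      using excess affine chord by (intro exI[of _ ?\<phi>]) (auto simp: algebra_simps)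
  next
    case False
    obtain c where c: "c \<in> {a..b}" "\<And>k. k \<in> {a..b} \<Longrightarrow> gap c \<le> gap k"
    proof -
      have "Min (gap ` {a..b}) \<in> gap ` {a..b}"
        using less.prems(1) by (intro Min_in) auto
      then obtain c where "c \<in> {a..b}" "gap c = Min (gap ` {a..b})" by auto
      then show ?thesis using that by simp
    qed
    have "gap c < 0" using False c by force
    moreover have "gap a = 0" "gap b = 0" using chord by (simp_all add: gap_def)
    ultimately have ac: "a < c" and cb: "c < b" using c(1) by (auto simp: order.order_iff_strict)
    have y1: "\<And>i j. i \<in> {a..c} \<Longrightarrow> j \<in> {a..c} \<Longrightarrow> y (i + j) \<le> u i + u j"
      using ac cb by (intro y) auto
    have "c - a < b - a" "a \<le> c" using ac cb by auto
    from less.hyps[OF this y1] obtain \<phi>1 where ends1: "\<phi>1 (2 * a) = 2 * u a" "\<phi>1 (2 * c) = 2 * u c"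
      and convex1: "\<forall>m\<in>{2 * a<..<2 * c}. 2 * \<phi>1 m \<le> \<phi>1 (m - 1) + \<phi>1 (Suc m)"
      and affine1: "\<forall>p q. (\<forall>i\<in>{a..c}. p + q * real i \<le> u i) \<longrightarrow>
        (\<forall>m\<in>{2 * a..2 * c}. 2 * p + q * real m \<le> \<phi>1 m)"
      and excess1: "(\<Sum>m\<in>{2 * a<..<2 * c}. max 0 (y m - \<phi>1 m)) + (\<Sum>k\<in>{a<..<c}. \<phi>1 (2 * k))
        \<le> 2 * (\<Sum>k\<in>{a<..<c}. u k)"
      by blast
    have y2: "\<And>i j. i \<in> {c..b} \<Longrightarrow> j \<in> {c..b} \<Longrightarrow> y (i + j) \<le> u i + u j"
      using ac cb by (intro y) auto
    have "b - c < b - a" "c \<le> b" using ac cb by auto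
    from less.hyps[OF this y2] obtain \<phi>2 where ends2: "\<phi>2 (2 * c) = 2 * u c" "\<phi>2 (2 * b) = 2 * u b"
      and convex2: "\<forall>m\<in>{2 * c<..<2 * b}. 2 * \<phi>2 m \<le> \<phi>2 (m - 1) + \<phi>2 (Suc m)"
      and affine2: "\<forall>p q. (\<forall>i\<in>{c..b}. p + q * real i \<le> u i) \<longrightarrow>
        (\<forall>m\<in>{2 * c..2 * b}. 2 * p + q * real m \<le> \<phi>2 m)"
      and excess2: "(\<Sum>m\<in>{2 * c<..<2 * b}. max 0 (y m - \<phi>2 m)) + (\<Sum>k\<in>{c<..<b}. \<phi>2 (2 * k))
        \<le> 2 * (\<Sum>k\<in>{c<..<b}. u k)"
      by blast
    define \<phi> where "\<phi> m = (if m \<le> 2 * c then \<phi>1 m else \<phi>2 m)" for m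
    have from_c: "\<phi> m = \<phi>2 m" if "2 * c \<le> m" for m
      using that ends1(2) ends2(1) by (auto simp: \<phi>_def)
    \<comment> \<open>The parallel to the chord through \<open>c\<close> supports \<open>u\<close> from below.\<close>
    have below: "u c - \<sigma> * real c + \<sigma> * real i \<le> u i" if "i \<in> {a..b}" for i
      using c(2)[OF that] by (simp add: gap_def algebra_simps)
    have left_c: "2 * u c - \<sigma> \<le> \<phi>1 (2 * c - 1)"
    proof -
      have "\<forall>i\<in>{a..c}. u c - \<sigma> * real c + \<sigma> * real i \<le> u i" using below cb by simp
      then have "2 * (u c - \<sigma> * real c) + \<sigma> * real (2 * c - 1) \<le> \<phi>1 (2 * c - 1)"
        by (intro affine1[rule_format]) (use ac in auto)
      then show ?thesis using ac by (simp add: of_nat_diff algebra_simps)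
    qed
    have right_c: "2 * u c + \<sigma> \<le> \<phi>2 (Suc (2 * c))"
    proof -
      have "\<forall>i\<in>{c..b}. u c - \<sigma> * real c + \<sigma> * real i \<le> u i" using below ac by simp
      then have "2 * (u c - \<sigma> * real c) + \<sigma> * real (Suc (2 * c)) \<le> \<phi>2 (Suc (2 * c))"
        by (intro affine2[rule_format]) (use cb in auto)
      then show ?thesis by (simp add: algebra_simps)
    qed
    have convex: "2 * \<phi> m \<le> \<phi> (m - 1) + \<phi> (Suc m)" if m: "m \<in> {2 * a<..<2 * b}" for m
    proof -
      consider (left) "m < 2 * c" | (middle) "m = 2 * c" | (right) "2 * c < m" by linarith
      then show ?thesis
      proof cases
        case left
        then have "\<phi> (m - 1) = \<phi>1 (m - 1)" "\<phi> m = \<phi>1 m" "\<phi> (Suc m) = \<phi>1 (Suc m)"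
          by (auto simp: \<phi>_def)
        then show ?thesis using bspec[OF convex1, of m] left m by simp
      next
        case middle
        then show ?thesis using left_c right_c ends1(2) by (simp add: \<phi>_def)
      next
        case right
        then have "\<phi> (m - 1) = \<phi>2 (m - 1)" "\<phi> m = \<phi>2 m" "\<phi> (Suc m) = \<phi>2 (Suc m)"
          by (simp_all add: from_c)
        then show ?thesis using bspec[OF convex2, of m] right m by simp
      qed
    qed
    have affine: "2 * p + q * real m \<le> \<phi> m"
      if pq: "\<forall>i\<in>{a..b}. p + q * real i \<le> u i" and m: "m \<in> {2 * a..2 * b}" for p q m
    proof (cases "m \<le> 2 * c")
      case True
      have "\<forall>i\<in>{a..c}. p + q * real i \<le> u i" using pq cb by simp
      then show ?thesis using affine1 True m by (simp add: \<phi>_def)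
    next
      case False
      have "\<forall>i\<in>{c..b}. p + q * real i \<le> u i" using pq ac by simp
      then show ?thesis using affine2 False m by (simp add: \<phi>_def)
    qed
    have splitm: "{2 * a<..<2 * b} = insert (2 * c) ({2 * a<..<2 * c} \<union> {2 * c<..<2 * b})"
      and splitk: "{a<..<b} = insert c ({a<..<c} \<union> {c<..<b})"
      using ac cb by auto
    have sm: "(\<Sum>m\<in>{2 * a<..<2 * b}. g m) = g (2 * c) + (\<Sum>m\<in>{2 * a<..<2 * c}. g m) + (\<Sum>m\<in>{2 * c<..<2 * b}. g m)"
      for g :: "nat \<Rightarrow> real"
      unfolding splitm by (subst sum.insert, simp, simp, subst sum.union_disjoint) auto
    have sk: "(\<Sum>m\<in>{a<..<b}. g m) = g c + (\<Sum>m\<in>{a<..<c}. g m) + (\<Sum>m\<in>{c<..<b}. g m)"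
      for g :: "nat \<Rightarrow> real"
      unfolding splitk by (subst sum.insert, simp, simp, subst sum.union_disjoint) auto
    have \<phi>c: "\<phi> (2 * c) = 2 * u c" using ends1(2) by (simp add: \<phi>_def)
    have "y (c + c) \<le> u c + u c" using ac cb by (intro y) auto
    then have "y (2 * c) \<le> 2 * u c" by (simp only: mult_2)
    then have "max 0 (y (2 * c) - \<phi> (2 * c)) = 0" by (simp add: \<phi>c)
    moreover have "(\<Sum>m\<in>{2 * a<..<2 * c}. max 0 (y m - \<phi> m)) = (\<Sum>m\<in>{2 * a<..<2 * c}. max 0 (y m - \<phi>1 m))"
      "(\<Sum>m\<in>{2 * c<..<2 * b}. max 0 (y m - \<phi> m)) = (\<Sum>m\<in>{2 * c<..<2 * b}. max 0 (y m - \<phi>2 m))"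
      "(\<Sum>k\<in>{a<..<c}. \<phi> (2 * k)) = (\<Sum>k\<in>{a<..<c}. \<phi>1 (2 * k))"
      "(\<Sum>k\<in>{c<..<b}. \<phi> (2 * k)) = (\<Sum>k\<in>{c<..<b}. \<phi>2 (2 * k))"
      by (intro sum.cong; simp add: \<phi>_def)+
    ultimately have "(\<Sum>m\<in>{2 * a<..<2 * b}. max 0 (y m - \<phi> m)) + (\<Sum>k\<in>{a<..<b}. \<phi> (2 * k))
        \<le> 2 * (\<Sum>k\<in>{a<..<b}. u k)"
      unfolding sm sk[of "\<lambda>k. \<phi> (2 * k)"] sk[of u] using excess1 excess2 \<phi>c by simp
    moreover have "\<phi> (2 * a) = 2 * u a" "\<phi> (2 * b) = 2 * u b"
      using ends1(1) ends2(2) ac cb by (simp_all add: \<phi>_def)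
    ultimately show ?thesis
      using convex affine by (intro exI[of _ \<phi>]) blast
  qed
qed

section \<open>The dual inequality\<close>

text \<open>
  Injectivity of \<open>\<mu>\<close> enters in one place: the sum of the excess \<open>max 0 (y m - \<phi> m)\<close> along \<open>\<mu>\<close>
  counts no \<open>m\<close> twice, so the bound on the total excess over \<open>{2..2n}\<close> applies.
\<close>

lemma dual_inequality:
  fixes \<mu> :: "nat \<Rightarrow> nat" and u y :: "nat \<Rightarrow> real"
  assumes n: "1 \<le> n"
    and range: "\<mu> ` {1..n} \<subseteq> {2..2 * n}"
    and top: "\<forall>I\<subseteq>{1..n}. (\<Sum>k\<in>I. real (\<mu> k)) \<le> real (card I) * (2 * real n + 1 - real (card I))"
    and total: "(\<Sum>k=1..n. real (\<mu> k)) = real n * (real n + 1)"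
    and inj: "inj_on \<mu> {1..n}"
    and y: "\<And>i j. i \<in> {1..n} \<Longrightarrow> j \<in> {1..n} \<Longrightarrow> y (i + j) \<le> u i + u j"
  shows "(\<Sum>k=1..n. y (\<mu> k)) \<le> 2 * (\<Sum>i=1..n. u i)"
proof -
  obtain \<phi> where "\<phi> (2 * 1) = 2 * u 1" and end_n: "\<phi> (2 * n) = 2 * u n"
    and "\<forall>m\<in>{2 * 1<..<2 * n}. 2 * \<phi> m \<le> \<phi> (m - 1) + \<phi> (Suc m)"
    and "(\<Sum>m\<in>{2 * 1<..<2 * n}. max 0 (y m - \<phi> m)) + (\<Sum>k\<in>{1<..<n}. \<phi> (2 * k))
        \<le> 2 * (\<Sum>k\<in>{1<..<n}. u k)"
    using convex_minorant[of 1 n y u, OF n y] by blast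
  then have end_1: "\<phi> 2 = 2 * u 1"
    and convex: "\<forall>m\<in>{2<..<2 * n}. 2 * \<phi> m \<le> \<phi> (m - 1) + \<phi> (Suc m)"
    and excess: "(\<Sum>m\<in>{2<..<2 * n}. max 0 (y m - \<phi> m)) + (\<Sum>k\<in>{1<..<n}. \<phi> (2 * k))
        \<le> 2 * (\<Sum>k\<in>{1<..<n}. u k)"
    by simp_all
  note ends = end_1 end_n
  have "y (1 + 1) \<le> u 1 + u 1" "y (n + n) \<le> u n + u n"
    using n by (intro y; simp)+
  then have "y 2 \<le> 2 * u 1" "y (2 * n) \<le> 2 * u n"
    by (simp_all only: one_add_one mult_2)
  then have "max 0 (y 2 - \<phi> 2) = 0" "max 0 (y (2 * n) - \<phi> (2 * n)) = 0"
    unfolding ends by simp_all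
  then have inner: "(\<Sum>m\<in>{2..2 * n}. max 0 (y m - \<phi> m)) = (\<Sum>m\<in>{2<..<2 * n}. max 0 (y m - \<phi> m))"
    by (intro sum.mono_neutral_right) (auto simp: order.order_iff_strict)
  have close: "(\<Sum>k=1..n. g k) = (\<Sum>k\<in>{1<..<n}. g k) + (\<Sum>k\<in>{1, n}. g k)" for g :: "nat \<Rightarrow> real"
  proof -
    have "{1..n} = {1<..<n} \<union> {1, n}" using n by auto
    then show ?thesis by (simp only:) (subst sum.union_disjoint, auto)
  qed
  have "(\<Sum>k\<in>{1, n}. \<phi> (2 * k)) = 2 * (\<Sum>k\<in>{1, n}. u k)"
    using ends by (cases "n = 1") auto
  then have excess': "(\<Sum>m\<in>{2..2 * n}. max 0 (y m - \<phi> m)) + (\<Sum>k=1..n. \<phi> (2 * k)) \<le> 2 * (\<Sum>k=1..n. u k)"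
    using excess inner close[of u] close[of "\<lambda>k. \<phi> (2 * k)"] by simp
  have "(\<Sum>k=1..n. y (\<mu> k)) \<le> (\<Sum>k=1..n. \<phi> (\<mu> k) + max 0 (y (\<mu> k) - \<phi> (\<mu> k)))"
    by (intro sum_mono) auto
  also have "\<dots> = (\<Sum>k=1..n. \<phi> (\<mu> k)) + (\<Sum>m\<in>\<mu> ` {1..n}. max 0 (y m - \<phi> m))"
    by (subst sum.reindex[OF inj]) (simp add: sum.distrib)
  also have "\<dots> \<le> (\<Sum>k=1..n. \<phi> (2 * k)) + (\<Sum>m\<in>{2..2 * n}. max 0 (y m - \<phi> m))"
    using range by (intro add_mono convex_majorization[OF range top total convex] sum_mono2) auto
  finally show ?thesis using excess' by simp
qed

section \<open>Distinct score vectors\<close>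

text \<open>
  The dual inequality turned into a solution of the primal problem. The constraints are indexed by
  positions (left summand, required value 2) and antidiagonals (right summand, required value 0 or
  1); a unit of mass in the cell \<open>(i, j)\<close> contributes to the positions \<open>i\<close> and \<open>j\<close> and to the
  antidiagonal \<open>i + j\<close>. Only the sum of the \<open>i\<close>-th row and the \<open>i\<close>-th column is controlled, which
  is enough after symmetrization.
\<close>

lemma antidiagonal_filling:
  fixes \<mu> :: "nat \<Rightarrow> nat"
  assumes n: "1 \<le> n"
    and range: "\<mu> ` {1..n} \<subseteq> {2..2 * n}"
    and top: "\<forall>I\<subseteq>{1..n}. (\<Sum>k\<in>I. real (\<mu> k)) \<le> real (card I) * (2 * real n + 1 - real (card I))"
    and total: "(\<Sum>k=1..n. real (\<mu> k)) = real n * (real n + 1)"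
    and inj: "inj_on \<mu> {1..n}"
  shows "\<exists>B :: nat \<times> nat \<Rightarrow> real. (\<forall>p\<in>{1..n} \<times> {1..n}. 0 \<le> B p)
    \<and> (\<forall>i\<in>{1..n}. (\<Sum>j=1..n. B (i, j)) + (\<Sum>j=1..n. B (j, i)) = 2)
    \<and> (\<forall>m\<in>{2..2 * n}. (\<Sum>(i, j)\<in>{(i, j) \<in> {1..n} \<times> {1..n}. i + j = m}. B (i, j)) = of_bool (m \<in> \<mu> ` {1..n}))"
proof -
  define G :: "nat \<times> nat \<Rightarrow> nat + nat \<Rightarrow> real" where
    "G = (\<lambda>(i, j). case_sum (\<lambda>k. of_bool (i = k) + of_bool (j = k)) (\<lambda>m. of_bool (i + j = m)))"
  define b :: "nat + nat \<Rightarrow> real" where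
    "b = case_sum (\<lambda>k. 2) (\<lambda>m. of_bool (m \<in> \<mu> ` {1..n}))"
  let ?I = "{1..n} <+> {2..2 * n}"
  have pick: "(\<Sum>k\<in>S. of_bool (i = k) * g k) = g i" if "finite S" "i \<in> S" for S and i :: nat and g :: "nat \<Rightarrow> real"
  proof -
    have "(\<Sum>k\<in>S. of_bool (i = k) * g k) = (\<Sum>k\<in>S. if i = k then g k else 0)"
      by (intro sum.cong) auto
    then show ?thesis using that by simp
  qed
  have "\<exists>B. (\<forall>p\<in>{1..n} \<times> {1..n}. 0 \<le> B p) \<and> (\<forall>x\<in>?I. b x = (\<Sum>p\<in>{1..n} \<times> {1..n}. B p * G p x))"
  proof (rule farkas)
    fix x :: "nat + nat \<Rightarrow> real"
    assume le: "\<And>p. p \<in> {1..n} \<times> {1..n} \<Longrightarrow> (\<Sum>z\<in>?I. G p z * x z) \<le> 0"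
    have "x (Inr (i + j)) \<le> - x (Inl i) + - x (Inl j)" if "i \<in> {1..n}" "j \<in> {1..n}" for i j
    proof -
      have "(\<Sum>z\<in>?I. G (i, j) z * x z) = x (Inl i) + x (Inl j) + x (Inr (i + j))"
        using that by (simp add: sum.Plus G_def distrib_right sum.distrib pick)
      then show ?thesis using le[of "(i, j)"] that by simp
    qed
    \<comment> \<open>A test vector is a dual solution with \<open>u\<^sub>i = - x (Inl i)\<close> and \<open>y(m) = x (Inr m)\<close>.\<close>
    then have "(\<Sum>k=1..n. x (Inr (\<mu> k))) \<le> 2 * (\<Sum>i=1..n. - x (Inl i))"
      by (intro dual_inequality[OF n range top total inj]) auto
    moreover have "(\<Sum>m\<in>{2..2 * n}. of_bool (m \<in> \<mu> ` {1..n}) * x (Inr m)) = (\<Sum>k=1..n. x (Inr (\<mu> k)))"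
    proof -
      have "(\<Sum>m\<in>{2..2 * n}. of_bool (m \<in> \<mu> ` {1..n}) * x (Inr m)) = (\<Sum>m\<in>\<mu> ` {1..n}. x (Inr m))"
        using range by (intro sum.mono_neutral_cong_right) auto
      also have "\<dots> = (\<Sum>k=1..n. x (Inr (\<mu> k)))"
        by (subst sum.reindex[OF inj]) simp
      finally show ?thesis .
    qed
    moreover have "(\<Sum>z\<in>?I. b z * x z) = 2 * (\<Sum>i=1..n. x (Inl i))
        + (\<Sum>m\<in>{2..2 * n}. of_bool (m \<in> \<mu> ` {1..n}) * x (Inr m))"
      unfolding b_def by (subst sum.Plus) (simp_all add: sum_distrib_left)
    ultimately show "(\<Sum>z\<in>?I. b z * x z) \<le> 0"
      unfolding sum_negf by linarith
  qed auto
  then obtain B where B: "\<forall>p\<in>{1..n} \<times> {1..n}. 0 \<le> B p"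
    and eq: "\<And>x. x \<in> ?I \<Longrightarrow> b x = (\<Sum>p\<in>{1..n} \<times> {1..n}. B p * G p x)" by blast
  have lines: "(\<Sum>j=1..n. B (i, j)) + (\<Sum>j=1..n. B (j, i)) = 2" if "i \<in> {1..n}" for i
  proof -
    have "2 = (\<Sum>k=1..n. \<Sum>j=1..n. B (k, j) * (of_bool (k = i) + of_bool (j = i)))"
      using eq[of "Inl i"] that by (simp add: b_def G_def sum.cartesian_product case_prod_unfold InlI)
    also have "\<dots> = (\<Sum>k=1..n. \<Sum>j=1..n. B (k, j) * of_bool (k = i))
        + (\<Sum>k=1..n. \<Sum>j=1..n. B (k, j) * of_bool (j = i))"
      by (simp add: distrib_left sum.distrib)
    also have "(\<Sum>k=1..n. \<Sum>j=1..n. B (k, j) * of_bool (k = i)) = (\<Sum>j=1..n. B (i, j))"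
      using that by (subst sum.swap) (simp add: of_bool_def if_distrib cong: if_cong)
    also have "(\<Sum>k=1..n. \<Sum>j=1..n. B (k, j) * of_bool (j = i)) = (\<Sum>j=1..n. B (j, i))"
      using that by (simp add: of_bool_def if_distrib cong: if_cong)
    finally show ?thesis by simp
  qed
  have antidiagonals: "(\<Sum>(i, j)\<in>{(i, j) \<in> {1..n} \<times> {1..n}. i + j = m}. B (i, j)) = of_bool (m \<in> \<mu> ` {1..n})"
    if "m \<in> {2..2 * n}" for m
  proof -
    have "of_bool (m \<in> \<mu> ` {1..n}) = (\<Sum>p\<in>{1..n} \<times> {1..n}. B p * G p (Inr m))"
      using eq[of "Inr m"] that by (simp add: b_def InrI)
    also have "\<dots> = (\<Sum>(i, j)\<in>{(i, j) \<in> {1..n} \<times> {1..n}. i + j = m}. B (i, j))"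
      by (intro sum.mono_neutral_cong_right) (auto simp: G_def)
    finally show ?thesis by simp
  qed
  show ?thesis
  proof (rule exI[of _ B], intro conjI)
    show "\<forall>p\<in>{1..n} \<times> {1..n}. 0 \<le> B p" by (rule B)
    show "\<forall>i\<in>{1..n}. (\<Sum>j=1..n. B (i, j)) + (\<Sum>j=1..n. B (j, i)) = 2"
      by (rule ballI) (rule lines)
    show "\<forall>m\<in>{2..2 * n}. (\<Sum>(i, j)\<in>{(i, j) \<in> {1..n} \<times> {1..n}. i + j = m}. B (i, j))
        = of_bool (m \<in> \<mu> ` {1..n})"
      by (rule ballI) (rule antidiagonals)
  qed
qed

theorem theorem1p7:
  fixes n :: nat and s :: "nat \<Rightarrow> int"
  assumes "n \<ge> 1"
    and "score_vector n s"
    and "inj_on s {1..n}"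
  shows "\<exists>A :: nat \<Rightarrow> nat \<Rightarrow> real. doubly_stochastic n A \<and>
           (\<forall>d \<in> diagonals n. xray n A d = real (frequency_vector n s d))"
proof -
  have score: "\<bar>\<Sum>i\<in>I. s i\<bar> \<le> int (card I) * (int n - int (card I))" if "I \<subseteq> {1..n}" for I
    using assms(2) that by (simp add: score_vector_def)
  define \<mu> where "\<mu> k = nat (s k + int n + 1)" for k
  have s: "\<bar>s k\<bar> \<le> int n - 1" if "k \<in> {1..n}" for k
    using score[of "{k}"] that by simp
  have \<mu>: "int (\<mu> k) = s k + int n + 1" if "k \<in> {1..n}" for k
    using s[OF that] by (simp add: \<mu>_def)
  have range: "\<mu> ` {1..n} \<subseteq> {2..2 * n}"
  proof (rule image_subsetI)
    fix k assume "k \<in> {1..n}"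
    from s[OF this] \<mu>[OF this] have "2 \<le> \<mu> k" "\<mu> k \<le> 2 * n" by linarith+
    then show "\<mu> k \<in> {2..2 * n}" by simp
  qed
  have sum_\<mu>: "(\<Sum>k\<in>I. real (\<mu> k)) = real_of_int (\<Sum>k\<in>I. s k) + real (card I) * (real n + 1)"
    if "I \<subseteq> {1..n}" for I
  proof -
    have "(\<Sum>k\<in>I. real (\<mu> k)) = (\<Sum>k\<in>I. real_of_int (s k) + (real n + 1))"
    proof (rule sum.cong)
      fix k assume "k \<in> I"
      then have "real_of_int (int (\<mu> k)) = real_of_int (s k + int n + 1)"
        using that \<mu>[of k] by auto
      then show "real (\<mu> k) = real_of_int (s k) + (real n + 1)" by simp
    qed simp
    then show ?thesis by (simp add: sum.distrib)
  qed
  have top: "\<forall>I\<subseteq>{1..n}. (\<Sum>k\<in>I. real (\<mu> k)) \<le> real (card I) * (2 * real n + 1 - real (card I))"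
  proof (intro allI impI)
    fix I :: "nat set" assume I: "I \<subseteq> {1..n}"
    have "real_of_int (\<Sum>k\<in>I. s k) \<le> real_of_int (int (card I) * (int n - int (card I)))"
      using score[OF I] by linarith
    then show "(\<Sum>k\<in>I. real (\<mu> k)) \<le> real (card I) * (2 * real n + 1 - real (card I))"
      using sum_\<mu>[OF I] by (simp add: algebra_simps)
  qed
  have total: "(\<Sum>k=1..n. real (\<mu> k)) = real n * (real n + 1)"
  proof -
    have "(\<Sum>k=1..n. s k) = 0" using score[of "{1..n}"] by simp
    then show ?thesis using sum_\<mu>[of "{1..n}"] by (simp only: subset_refl card_atLeastAtMost) simp
  qed
  have inj: "inj_on \<mu> {1..n}"
  proof (rule inj_onI)
    fix k l assume kl: "k \<in> {1..n}" "l \<in> {1..n}" "\<mu> k = \<mu> l"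
    then have "s k = s l" using \<mu>[of k] \<mu>[of l] by simp
    then show "k = l" by (rule inj_onD[OF assms(3) _ kl(1,2)])
  qed
  obtain B where nonneg: "\<forall>p\<in>{1..n} \<times> {1..n}. 0 \<le> B p"
    and lines: "\<forall>i\<in>{1..n}. (\<Sum>j=1..n. B (i, j)) + (\<Sum>j=1..n. B (j, i)) = (2::real)"
    and diags: "\<forall>m\<in>{2..2 * n}.
      (\<Sum>(i, j)\<in>{(i, j) \<in> {1..n} \<times> {1..n}. i + j = m}. B (i, j)) = of_bool (m \<in> \<mu> ` {1..n})"
    using antidiagonal_filling[OF assms(1) range top total inj] by blast
  note B = bspec[OF nonneg] and line = bspec[OF lines] and diag = bspec[OF diags]
  \<comment> \<open>Symmetrize the filling and undo the reversal of the columns.\<close>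
  define A where "A i j = (B (i, n + 1 - j) + B (n + 1 - j, i)) / 2" for i j
  have flip: "(\<Sum>j=1..n. g (n + 1 - j)) = (\<Sum>j=1..n. g j)" for g :: "nat \<Rightarrow> real"
    by (rule sum.reindex_bij_witness[of _ "\<lambda>j. n + 1 - j" "\<lambda>j. n + 1 - j"]) auto
  have "doubly_stochastic n A"
    unfolding doubly_stochastic_def
  proof (intro conjI ballI)
    fix i j assume i: "i \<in> {1..n}" and "j \<in> {1..n}"
    then have j: "n + 1 - j \<in> {1..n}" by auto
    have "0 \<le> B (i, n + 1 - j)" "0 \<le> B (n + 1 - j, i)"
      by (rule B, rule SigmaI, rule i, rule j) (rule B, rule SigmaI, rule j, rule i)
    then show "0 \<le> A i j" by (simp only: A_def add_nonneg_nonneg divide_nonneg_pos zero_less_numeral)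
  next
    fix i assume i: "i \<in> {1..n}"
    have "(\<Sum>j=1..n. A i j) = (\<Sum>j=1..n. (B (i, j) + B (j, i)) / 2)"
      unfolding A_def by (rule flip)
    also have "\<dots> = ((\<Sum>j=1..n. B (i, j)) + (\<Sum>j=1..n. B (j, i))) / 2"
      by (simp only: sum_divide_distrib[symmetric] sum.distrib)
    finally show "(\<Sum>j=1..n. A i j) = 1" using line[OF i] by simp
  next
    fix j assume "j \<in> {1..n}"
    then have j: "n + 1 - j \<in> {1..n}" by auto
    have "(\<Sum>i=1..n. A i j) = ((\<Sum>i=1..n. B (i, n + 1 - j)) + (\<Sum>i=1..n. B (n + 1 - j, i))) / 2"
      by (simp only: A_def sum_divide_distrib[symmetric] sum.distrib)
    also have "\<dots> = 2 / 2"
      by (subst add.commute) (simp only: line[OF j])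
    finally show "(\<Sum>i=1..n. A i j) = 1" by simp
  qed
  moreover have "xray n A d = real (frequency_vector n s d)" if d: "d \<in> diagonals n" for d
  proof -
    define m where "m = nat (d + int n + 1)"
    have m: "int m = d + int n + 1" "m \<in> {2..2 * n}"
      using d by (auto simp: m_def diagonals_def)
    let ?S = "{(i, j) \<in> {1..n} \<times> {1..n}. i + j = m}"
    have "xray n A d = (\<Sum>(i, j)\<in>?S. (B (i, j) + B (j, i)) / 2)"
      unfolding xray_def
      by (rule sum.reindex_bij_witness[of _ "\<lambda>(i, j). (i, n + 1 - j)" "\<lambda>(i, j). (i, n + 1 - j)"])
         (use m(1) in \<open>auto simp: A_def of_nat_diff\<close>)
    also have "\<dots> = ((\<Sum>(i, j)\<in>?S. B (i, j)) + (\<Sum>(i, j)\<in>?S. B (j, i))) / 2"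
      by (simp add: case_prod_unfold sum.distrib sum_divide_distrib[symmetric])
    also have "(\<Sum>(i, j)\<in>?S. B (j, i)) = (\<Sum>(i, j)\<in>?S. B (i, j))"
      by (rule sum.reindex_bij_witness[of _ prod.swap prod.swap]) auto
    finally have x: "xray n A d = of_bool (m \<in> \<mu> ` {1..n})"
      using diag[OF m(2)] by simp
    have "m = \<mu> k \<longleftrightarrow> s k = d" if "k \<in> {1..n}" for k
      using m(1) \<mu>[OF that] by linarith
    then have im: "m \<in> \<mu> ` {1..n} \<longleftrightarrow> (\<exists>k\<in>{1..n}. s k = d)"
      unfolding image_iff by (rule bex_cong[OF refl])
    have "frequency_vector n s d = of_bool (\<exists>k\<in>{1..n}. s k = d)"
    proof (cases "\<exists>k\<in>{1..n}. s k = d")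
      case True
      then obtain k where k: "k \<in> {1..n}" "s k = d" by blast
      have "{i \<in> {1..n}. s i = d} = {k}"
      proof (intro equalityI subsetI)
        fix i assume i: "i \<in> {i \<in> {1..n}. s i = d}"
        then have "i \<in> {1..n}" "s i = s k" using k(2) by auto
        then show "i \<in> {k}" using inj_onD[OF assms(3) \<open>s i = s k\<close> _ k(1)] by simp
      qed (use k in simp)
      then show ?thesis unfolding frequency_vector_def using True by (simp only: card_1_singleton_iff) simp
    next
      case False
      then have "{i \<in> {1..n}. s i = d} = {}" by blast
      then show ?thesis unfolding frequency_vector_def using False by (simp only: card.empty of_bool_eq)
    qed
    then show ?thesis using x im by simp
  qed
  ultimately show ?thesis by blast
qed

end
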